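(* Every J-stable ring is strongly completable.
   Context: All rings are commutative with identity. $J(R)$ denotes the Jacobson radical of $R$. A ring $R$ has stable range $1$ if whenever $aR+bR=R$ with $a,b\in R$, there is $y\in R$ such that $a+by$ is invertible. A ring $R$ is J-stable if $R/aR$ has stable range $1$ for all $a\in R$ with $a\notin J(R)$. A ring $R$ is strongly completable if for every integer $n\ge 2$ and all $a_1,\dots,a_n,d\in R$ with $a_1R+\cdots+a_nR=dR$, there is an $n\times n$ matrix $A$ over $R$ whose first row is $a_1,\dots,a_n$ and with $\det(A)=d$. *)

theory Defs
  imports "HOL-Algebra.QuotRing" "Jordan_Normal_Form.Determinant"
begin

text \<open>
  Rings are records in the sense of HOL-Algebra, with commutativity given by \<^locale>\<open>cring\<close>.
  In particular the zero ring is allowed; it arises as the quotient \<open>R/aR\<close> when \<open>a\<close> is a unit.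
\<close>

definition jacobson_radical :: "('a, 'b) ring_scheme \<Rightarrow> 'a set" where
  "jacobson_radical R = {x \<in> carrier R. \<forall>M. maximalideal M R \<longrightarrow> x \<in> M}"

definition stable_range_1 :: "('a, 'b) ring_scheme \<Rightarrow> bool" where
  "stable_range_1 R \<longleftrightarrow>
     (\<forall>a \<in> carrier R. \<forall>b \<in> carrier R.
        PIdl\<^bsub>R\<^esub> a <+>\<^bsub>R\<^esub> PIdl\<^bsub>R\<^esub> b = carrier R \<longrightarrow>
        (\<exists>y \<in> carrier R. a \<oplus>\<^bsub>R\<^esub> b \<otimes>\<^bsub>R\<^esub> y \<in> Units R))"

definition J_stable :: "('a, 'b) ring_scheme \<Rightarrow> bool" where
  "J_stable R \<longleftrightarrow>
     (\<forall>a \<in> carrier R. a \<notin> jacobson_radical R \<longrightarrow> stable_range_1 (R Quot (PIdl\<^bsub>R\<^esub> a)))"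

text \<open>
  The set \<open>a\<^sub>1R + \<dots> + a\<^sub>nR\<close>, for \<open>v = (a\<^sub>1, \<dots>, a\<^sub>n)\<close>.
\<close>

definition span_vec :: "('a, 'b) ring_scheme \<Rightarrow> 'a vec \<Rightarrow> 'a set" where
  "span_vec R v =
     {\<Oplus>\<^bsub>R\<^esub>i\<in>{0..<dim_vec v}. v $ i \<otimes>\<^bsub>R\<^esub> x i | x. x \<in> {0..<dim_vec v} \<rightarrow> carrier R}"

text \<open>
  The constant \<^const>\<open>det\<close> is confined to rings given by a type class, so the Leibniz formula
  is restated here for ring records. The two agree, see \<open>det_in_type_ring\<close> below.
\<close>

definition det_in :: "('a, 'b) ring_scheme \<Rightarrow> 'a mat \<Rightarrow> 'a" where
  "det_in R A =
     (\<Oplus>\<^bsub>R\<^esub>p\<in>{p. p permutes {0..<dim_row A}}.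
        let t = \<Otimes>\<^bsub>R\<^esub>i\<in>{0..<dim_row A}. A $$ (i, p i)
        in if evenperm p then t else \<ominus>\<^bsub>R\<^esub> t)"

definition strongly_completable :: "('a, 'b) ring_scheme \<Rightarrow> bool" where
  "strongly_completable R \<longleftrightarrow>
     (\<forall>n\<ge>2. \<forall>v \<in> carrier_vec n. \<forall>d \<in> carrier R.
        set\<^sub>v v \<subseteq> carrier R \<longrightarrow> span_vec R v = PIdl\<^bsub>R\<^esub> d \<longrightarrow>
        (\<exists>A \<in> carrier_mat n n.
           elements_mat A \<subseteq> carrier R \<and> row A 0 = v \<and> det_in R A = d))"

abbreviation type_ring :: "'a :: comm_ring_1 ring" where
  "type_ring \<equiv> \<lparr>carrier = UNIV, monoid.mult = (*), one = 1, zero = 0, add = (+)\<rparr>"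

lemma cring_type_ring: "cring (type_ring :: 'a :: comm_ring_1 ring)"
proof (rule cringI)
  show "abelian_group (type_ring :: 'a ring)"
    by (rule abelian_groupI) (auto simp: algebra_simps intro: exI[of _ "- x" for x])
  show "comm_monoid (type_ring :: 'a ring)"
    by (rule comm_monoidI) (auto simp: algebra_simps)
qed (auto simp: algebra_simps)

lemma det_in_type_ring:
  fixes A :: "'a :: comm_ring_1 mat"
  assumes "A \<in> carrier_mat n n"
  shows "det_in type_ring A = det A"
proof -
  interpret cring "type_ring :: 'a ring" by (rule cring_type_ring)
  have S: "finsum (type_ring :: 'a ring) f B = sum f B" if "finite B" for f :: "'c \<Rightarrow> 'a" and B
    using that by induction auto
  have P: "finprod (type_ring :: 'a ring) f B = prod f B" if "finite B" for f :: "'c \<Rightarrow> 'a" and B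
    using that by induction auto
  have N: "\<ominus>\<^bsub>type_ring\<^esub> x = - x" for x :: 'a
    using minus_equality[of "- x" x] by simp
  show ?thesis
    unfolding det_in_def det_def Let_def N using assms
    by (auto simp: S P finite_permutations sign_def intro!: sum.cong)
qed

end

theory Submission
  imports Defs "HOL-Algebra.Ring_Divisibility"
begin

text \<open>
  Write \<open>\<Sum> a\<^sub>k x\<^sub>k = d\<close> and \<open>a\<^sub>k = d b\<^sub>k\<close>. When \<open>d\<close> is a zero divisor, the \<open>b\<^sub>k\<close> need not
  generate the unit ideal; but \<open>e = 1 - b\<^sub>0 x\<^sub>0 - b\<^sub>1 x\<^sub>1\<close> satisfies
  \<open>d e = \<Sum>\<^bsub>k \<ge> 2\<^esub> a\<^sub>k x\<^sub>k\<close>, and \<open>b\<^sub>0, b\<^sub>1, e\<close> do generate it.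

  The one consequence of J-stability that is used is that a J-stable ring has stable range at
  most 2 (\<open>J_stable_shorten\<close>). It yields \<open>s, t, u, v\<close> with
  \<open>(b\<^sub>0 + e s) u + (b\<^sub>1 + e t) v = 1\<close>. Multiplying by \<open>d\<close> turns this into

    \<open>d = (a\<^sub>0 + \<Sum>\<^bsub>k \<ge> 2\<^esub> a\<^sub>k p\<^sub>k) u + (a\<^sub>1 + \<Sum>\<^bsub>k \<ge> 2\<^esub> a\<^sub>k q\<^sub>k) v\<close>,

  where \<open>p\<^sub>k = x\<^sub>k s\<close> and \<open>q\<^sub>k = x\<^sub>k t\<close> (\<open>J_stable_two_term_combination\<close>).

  The right-hand side is the determinant of the matrix with the rows

    \<open>(a\<^sub>0, a\<^sub>1, a\<^sub>2, \<dots>, a\<^bsub>n-1\<^esub>)\<close>,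
    \<open>(-v, u, 0, \<dots>, 0)\<close>, and
    \<open>(-p\<^sub>k, -q\<^sub>k, 0, \<dots>, 1, \<dots>, 0)\<close> with the \<open>1\<close> on the diagonal, for \<open>2 \<le> k < n\<close>.

  Indeed, adding \<open>p\<^sub>k\<close> times column \<open>k\<close> to column 0 and \<open>q\<^sub>k\<close> times column \<open>k\<close> to column 1,
  for all \<open>k \<ge> 2\<close>, makes it block upper triangular: the first block is \<open>2 \<times> 2\<close>, with the
  asserted determinant, and the second one is an identity matrix. Since \<^const>\<open>det_in\<close> is a
  bare Leibniz sum, \<open>det_in_bordered_mat\<close> evaluates that sum directly: the zeros leave only
  \<open>2 (n - 1)\<close> permutations.
\<close>

section \<open>J-stable rings have stable range at most 2\<close>

lemma (in ring) maximalideal_exists: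
  assumes "\<one> \<noteq> \<zero>"
  shows "\<exists>M. maximalideal M R"
proof -
  let ?A = "{I. ideal I R \<and> \<one> \<notin> I}"
  have "\<exists>M\<in>?A. \<forall>X\<in>?A. M \<subseteq> X \<longrightarrow> X = M"
  proof (rule subset_Zorn_nonempty)
    show "?A \<noteq> {}" using zeroideal assms by blast
  next
    fix C assume C: "C \<noteq> {}" "subset.chain ?A C"
    then have "subset.chain {I. ideal I R} C"
      unfolding subset.chain_def by auto
    from chain_Union_is_ideal[OF this] C show "\<Union>C \<in> ?A"
      unfolding subset.chain_def by auto
  qed
  then obtain M where M: "ideal M R" "\<one> \<notin> M"
    and max: "\<And>X. ideal X R \<Longrightarrow> \<one> \<notin> X \<Longrightarrow> M \<subseteq> X \<Longrightarrow> X = M" by auto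
  have "maximalideal M R"
    using M max ideal.one_imp_carrier by (intro maximalidealI) blast+
  then show ?thesis ..
qed

text \<open>
  The hypothesis says that \<open>b\<close> and \<open>e\<close> generate the unit ideal modulo \<open>a\<close>, so that the stable
  range condition of the quotient applies; an inverse there lifts to a relation modulo \<open>a\<close>.
\<close>

lemma (in cring) stable_range_1_quotient_lift:
  assumes sr: "stable_range_1 (R Quot (PIdl a))"
    and carr: "a \<in> carrier R" "b \<in> carrier R" "e \<in> carrier R"
      "x \<in> carrier R" "y \<in> carrier R" "z \<in> carrier R"
    and comb: "a \<otimes> x \<oplus> b \<otimes> y \<oplus> e \<otimes> z = \<one>"
  shows "\<exists>w\<in>carrier R. \<exists>u\<in>carrier R. \<exists>v\<in>carrier R.
           a \<otimes> u \<oplus> (b \<oplus> e \<otimes> w) \<otimes> v = \<one>"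
proof -
  let ?I = "PIdl a"
  let ?Q = "R Quot ?I"
  let ?h = "\<lambda>r. ?I +> r"
  interpret I: ideal ?I R by (rule cgenideal_ideal) (rule carr(1))
  interpret Q: cring ?Q by (rule I.quotient_is_cring) (rule is_cring)
  note h_simps = ring_hom_closed[OF I.rcos_ring_hom] ring_hom_one[OF I.rcos_ring_hom]
    ring_hom_add[OF I.rcos_ring_hom] ring_hom_mult[OF I.rcos_ring_hom]
  have surj: "\<exists>r\<in>carrier R. ?h r = X" if "X \<in> carrier ?Q" for X
    using that by (auto simp: FactRing_simps)
  have kernel: "?h r = ?h s \<longleftrightarrow> r \<ominus> s \<in> ?I" if "r \<in> carrier R" "s \<in> carrier R" for r s
    using quotient_eq_iff_same_a_r_cos[OF I.is_ideal that] by auto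
  have "a \<otimes> x \<in> ?I"
    using carr by (simp add: I.I_r_closed cgenideal_self)
  moreover have "\<one> \<ominus> (b \<otimes> y \<oplus> e \<otimes> z) = a \<otimes> x"
    unfolding comb[symmetric] using carr by algebra
  ultimately have "?h \<one> = ?h (b \<otimes> y \<oplus> e \<otimes> z)"
    using carr by (subst kernel) auto
  then have one: "\<one>\<^bsub>?Q\<^esub> = ?h y \<otimes>\<^bsub>?Q\<^esub> ?h b \<oplus>\<^bsub>?Q\<^esub> ?h z \<otimes>\<^bsub>?Q\<^esub> ?h e"
    using carr by (simp add: h_simps Q.m_comm)
  interpret S: ideal "PIdl\<^bsub>?Q\<^esub> (?h b) <+>\<^bsub>?Q\<^esub> PIdl\<^bsub>?Q\<^esub> (?h e)" ?Q
    using carr by (intro Q.add_ideals Q.cgenideal_ideal) (auto simp: h_simps)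
  have "\<one>\<^bsub>?Q\<^esub> \<in> PIdl\<^bsub>?Q\<^esub> (?h b) <+>\<^bsub>?Q\<^esub> PIdl\<^bsub>?Q\<^esub> (?h e)"
  proof -
    have "r \<otimes>\<^bsub>?Q\<^esub> c \<in> PIdl\<^bsub>?Q\<^esub> c" if "r \<in> carrier ?Q" for r c
      unfolding cgenideal_def[of ?Q] using that by blast
    then show ?thesis
      unfolding one set_add_def' using h_simps(1) carr by blast
  qed
  then have "PIdl\<^bsub>?Q\<^esub> (?h b) <+>\<^bsub>?Q\<^esub> PIdl\<^bsub>?Q\<^esub> (?h e) = carrier ?Q"
    by (rule S.one_imp_carrier)
  then obtain W where W: "W \<in> carrier ?Q" and unit: "?h b \<oplus>\<^bsub>?Q\<^esub> ?h e \<otimes>\<^bsub>?Q\<^esub> W \<in> Units ?Q"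
    using sr carr unfolding stable_range_1_def by (meson h_simps(1))
  from unit obtain V where V: "V \<in> carrier ?Q"
    "(?h b \<oplus>\<^bsub>?Q\<^esub> ?h e \<otimes>\<^bsub>?Q\<^esub> W) \<otimes>\<^bsub>?Q\<^esub> V = \<one>\<^bsub>?Q\<^esub>"
    unfolding Units_def by auto
  obtain w where w: "w \<in> carrier R" "?h w = W"
    using surj[OF W] by (elim bexE)
  obtain v where v: "v \<in> carrier R" "?h v = V"
    using surj[OF V(1)] by (elim bexE)
  have "?h \<one> = ?h ((b \<oplus> e \<otimes> w) \<otimes> v)"
    using V(2) w v carr by (simp add: h_simps)
  then have "\<one> \<ominus> (b \<oplus> e \<otimes> w) \<otimes> v \<in> ?I"
    using kernel w v carr by simp
  then obtain u where u: "u \<in> carrier R" "\<one> \<ominus> (b \<oplus> e \<otimes> w) \<otimes> v = a \<otimes> u"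
    unfolding cgenideal_def using carr m_comm by auto
  have "a \<otimes> u \<oplus> (b \<oplus> e \<otimes> w) \<otimes> v = \<one>"
    unfolding u(2)[symmetric] using carr w v by algebra
  with u(1) w(1) v(1) show ?thesis by blast
qed

text \<open>
  Stable range at most 2. The quotient condition handles the triple once \<open>a\<close>, \<open>b\<close> or \<open>a + e\<close> lies
  outside the Jacobson radical; the third element is useful because \<open>a + e, b, e\<close> generate the
  same ideal as \<open>a, b, e\<close>. If all three lie in the radical, then so do \<open>e\<close> and hence \<open>1\<close>; so
  there is no maximal ideal, and the ring is zero.
\<close>

lemma (in cring) J_stable_shorten:
  assumes J: "J_stable R"
    and carr: "a \<in> carrier R" "b \<in> carrier R" "e \<in> carrier R"
      "x \<in> carrier R" "y \<in> carrier R" "z \<in> carrier R"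
    and comb: "a \<otimes> x \<oplus> b \<otimes> y \<oplus> e \<otimes> z = \<one>"
  shows "\<exists>s\<in>carrier R. \<exists>t\<in>carrier R. \<exists>u\<in>carrier R. \<exists>v\<in>carrier R.
           (a \<oplus> e \<otimes> s) \<otimes> u \<oplus> (b \<oplus> e \<otimes> t) \<otimes> v = \<one>"
proof -
  have sr: "stable_range_1 (R Quot (PIdl r))"
    if "r \<in> carrier R" "r \<notin> jacobson_radical R" for r
    using J that unfolding J_stable_def by blast
  consider "a \<notin> jacobson_radical R" | "b \<notin> jacobson_radical R"
    | "a \<oplus> e \<notin> jacobson_radical R"
    | "a \<in> jacobson_radical R" "b \<in> jacobson_radical R" "a \<oplus> e \<in> jacobson_radical R"
    by blast
  then show ?thesis
  proof cases
    case 1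
    obtain w u v where "w \<in> carrier R" "u \<in> carrier R" "v \<in> carrier R"
      "a \<otimes> u \<oplus> (b \<oplus> e \<otimes> w) \<otimes> v = \<one>"
      using stable_range_1_quotient_lift[OF sr[OF carr(1) 1] carr comb] by blast
    moreover from this carr have "(a \<oplus> e \<otimes> \<zero>) \<otimes> u \<oplus> (b \<oplus> e \<otimes> w) \<otimes> v = \<one>" by simp
    ultimately show ?thesis by blast
  next
    case 2
    have "b \<otimes> y \<oplus> a \<otimes> x \<oplus> e \<otimes> z = \<one>"
      using comb carr by (simp add: a_comm)
    with 2 carr obtain w u v where w: "w \<in> carrier R" "u \<in> carrier R" "v \<in> carrier R"
      "b \<otimes> u \<oplus> (a \<oplus> e \<otimes> w) \<otimes> v = \<one>"
      using stable_range_1_quotient_lift[OF sr[OF carr(2) 2], of a e y x z] by blast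
    then have "(a \<oplus> e \<otimes> w) \<otimes> v \<oplus> (b \<oplus> e \<otimes> \<zero>) \<otimes> u = \<one>"
      using carr by (simp add: a_comm)
    with w show ?thesis by blast
  next
    case 3
    have ae: "a \<oplus> e \<in> carrier R" using carr by simp
    \<comment> \<open>Replacing \<open>a\<close> by \<open>a \<oplus> e\<close> is undone in the coefficient of \<open>e\<close>, and it accounts for
      the witness \<open>s = \<one>\<close>.\<close>
    have "(a \<oplus> e) \<otimes> x \<oplus> b \<otimes> y \<oplus> e \<otimes> (z \<ominus> x) = \<one>"
      unfolding comb[symmetric] using carr by algebra
    with carr obtain w u v where w: "w \<in> carrier R" "u \<in> carrier R" "v \<in> carrier R"
      "(a \<oplus> e) \<otimes> u \<oplus> (b \<oplus> e \<otimes> w) \<otimes> v = \<one>"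
      using stable_range_1_quotient_lift[OF sr[OF ae 3], of b e x y "z \<ominus> x"] by blast
    then have "(a \<oplus> e \<otimes> \<one>) \<otimes> u \<oplus> (b \<oplus> e \<otimes> w) \<otimes> v = \<one>"
      using carr by simp
    with w show ?thesis by blast
  next
    case 4
    have "\<one> = \<zero>"
    proof (rule ccontr)
      assume "\<one> \<noteq> \<zero>"
      then obtain M where M: "maximalideal M R"
        using maximalideal_exists by blast
      interpret M: maximalideal M R by fact
      have mem: "a \<in> M" "b \<in> M" "a \<oplus> e \<in> M"
        using 4 M unfolding jacobson_radical_def by auto
      have "(a \<oplus> e) \<ominus> a \<in> M"
        using mem by (simp add: a_minus_def)
      moreover have "(a \<oplus> e) \<ominus> a = e"
        using carr by algebra
      ultimately have "a \<otimes> x \<oplus> b \<otimes> y \<oplus> e \<otimes> z \<in> M"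
        using mem carr by (simp add: M.I_r_closed)
      then show False
        using comb M.one_imp_carrier M.I_notcarr by auto
    qed
    moreover have "(a \<oplus> e \<otimes> \<zero>) \<otimes> \<zero> \<oplus> (b \<oplus> e \<otimes> \<zero>) \<otimes> \<zero> = \<zero>"
      using carr by simp
    ultimately have "(a \<oplus> e \<otimes> \<zero>) \<otimes> \<zero> \<oplus> (b \<oplus> e \<otimes> \<zero>) \<otimes> \<zero> = \<one>"
      by metis
    then show ?thesis by blast
  qed
qed

lemma (in cring) J_stable_two_term_combination:
  fixes n :: nat
  assumes J: "J_stable R"
    and n: "n \<ge> 2"
    and a: "\<And>k. k < n \<Longrightarrow> a k \<in> carrier R"
    and d: "d \<in> carrier R"
    and span: "{\<Oplus>k\<in>{0..<n}. a k \<otimes> x k | x. x \<in> {0..<n} \<rightarrow> carrier R} = PIdl d"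
  obtains p q u v where
    "\<And>k. k < n \<Longrightarrow> p k \<in> carrier R" "\<And>k. k < n \<Longrightarrow> q k \<in> carrier R"
    "u \<in> carrier R" "v \<in> carrier R"
    "d = (a 0 \<oplus> (\<Oplus>k\<in>{2..<n}. a k \<otimes> p k)) \<otimes> u \<oplus> (a 1 \<oplus> (\<Oplus>k\<in>{2..<n}. a k \<otimes> q k)) \<otimes> v"
proof -
  have idx: "{0..<n} = insert 0 (insert 1 {2..<n})" using n by auto
  have "d \<in> PIdl d" using d by (rule cgenideal_self)
  then obtain x where x: "x \<in> {0..<n} \<rightarrow> carrier R" and dx: "d = (\<Oplus>k\<in>{0..<n}. a k \<otimes> x k)"
    using span by auto
  have xk: "x k \<in> carrier R" if "k < n" for k using x that by auto
  have "\<exists>b\<in>carrier R. a k = d \<otimes> b" if k: "k < n" for k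
  proof -
    \<comment> \<open>A unit vector of coefficients puts \<open>a k\<close> itself into the span.\<close>
    let ?\<delta> = "\<lambda>i. if k = i then \<one> else \<zero>"
    have "(\<Oplus>i\<in>{0..<n}. a i \<otimes> ?\<delta> i) = (\<Oplus>i\<in>{0..<n}. if k = i then a i else \<zero>)"
      using a by (intro finsum_cong') auto
    also have "\<dots> = a k"
      using k a by (intro add.finprod_singleton) auto
    finally have "a k \<in> PIdl d"
      unfolding span[symmetric] by (auto intro!: exI[of _ ?\<delta>])
    then show ?thesis
      unfolding cgenideal_def using d m_comm by auto
  qed
  then obtain b0 b1 where b: "b0 \<in> carrier R" "b1 \<in> carrier R" "a 0 = d \<otimes> b0" "a 1 = d \<otimes> b1"
    using n by (metis less_le_trans pos2 one_less_numeral_iff semiring_norm(76))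
  \<comment> \<open>\<open>E\<close> turns out to be \<open>d \<otimes> e\<close>, which is how the indices \<open>k \<ge> 2\<close> enter.\<close>
  define E where "E = (\<Oplus>k\<in>{2..<n}. a k \<otimes> x k)"
  define e where "e = \<one> \<ominus> b0 \<otimes> x 0 \<ominus> b1 \<otimes> x 1"
  have x01: "x 0 \<in> carrier R" "x 1 \<in> carrier R" using xk n by auto
  have e: "e \<in> carrier R" unfolding e_def using b x01 by simp
  have E: "E \<in> carrier R" unfolding E_def using a xk by (intro finsum_closed) auto
  have "d = a 0 \<otimes> x 0 \<oplus> (a 1 \<otimes> x 1 \<oplus> E)"
    unfolding dx idx E_def using a xk n by (subst finsum_insert; (subst finsum_insert)?) auto
  then have dE: "d = d \<otimes> b0 \<otimes> x 0 \<oplus> (d \<otimes> b1 \<otimes> x 1 \<oplus> E)"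
    using b by simp
  have "d \<otimes> e = d \<ominus> d \<otimes> b0 \<otimes> x 0 \<ominus> d \<otimes> b1 \<otimes> x 1"
    unfolding e_def using d b x01 by algebra
  also have "\<dots> = (d \<otimes> b0 \<otimes> x 0 \<oplus> (d \<otimes> b1 \<otimes> x 1 \<oplus> E)) \<ominus> d \<otimes> b0 \<otimes> x 0 \<ominus> d \<otimes> b1 \<otimes> x 1"
    using dE by simp
  also have "\<dots> = E" using d b x01 E by algebra
  finally have de: "d \<otimes> e = E" .
  have "b0 \<otimes> x 0 \<oplus> b1 \<otimes> x 1 \<oplus> e \<otimes> \<one> = \<one>"
    unfolding e_def using b x01 by algebra
  then obtain s t u v where st: "s \<in> carrier R" "t \<in> carrier R" "u \<in> carrier R" "v \<in> carrier R"
    and uv: "(b0 \<oplus> e \<otimes> s) \<otimes> u \<oplus> (b1 \<oplus> e \<otimes> t) \<otimes> v = \<one>"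
    using J_stable_shorten[OF J b(1,2) e x01 one_closed] by blast
  have pull: "(\<Oplus>k\<in>{2..<n}. a k \<otimes> (x k \<otimes> r)) = d \<otimes> e \<otimes> r" if "r \<in> carrier R" for r
  proof -
    have "(\<Oplus>k\<in>{2..<n}. a k \<otimes> (x k \<otimes> r)) = (\<Oplus>k\<in>{2..<n}. a k \<otimes> x k \<otimes> r)"
      using a xk that by (intro finsum_cong') (auto simp: m_assoc)
    also have "\<dots> = E \<otimes> r"
      unfolding E_def using a xk that by (intro finsum_ldistr[symmetric]) auto
    finally show ?thesis using de by simp
  qed
  have "d = d \<otimes> ((b0 \<oplus> e \<otimes> s) \<otimes> u \<oplus> (b1 \<oplus> e \<otimes> t) \<otimes> v)"
    using uv d by simp
  also have "\<dots> = (d \<otimes> b0 \<oplus> d \<otimes> e \<otimes> s) \<otimes> u \<oplus> (d \<otimes> b1 \<oplus> d \<otimes> e \<otimes> t) \<otimes> v"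
    using d b e st by algebra
  finally show thesis
    using that[of "\<lambda>k. x k \<otimes> s" "\<lambda>k. x k \<otimes> t" u v] st xk b pull by simp
qed

section \<open>The determinant of a bordered matrix\<close>

definition bordered_mat ::
  "('a, 'b) ring_scheme \<Rightarrow> nat \<Rightarrow> (nat \<Rightarrow> 'a) \<Rightarrow> (nat \<Rightarrow> 'a) \<Rightarrow> (nat \<Rightarrow> 'a) \<Rightarrow> 'a \<Rightarrow> 'a \<Rightarrow> 'a mat"
  where
  "bordered_mat R n a p q u v = mat n n (\<lambda>(i, j).
     if i = 0 then a j
     else if i = 1 then (if j = 0 then \<ominus>\<^bsub>R\<^esub> v else if j = 1 then u else \<zero>\<^bsub>R\<^esub>)
     else if j = 0 then \<ominus>\<^bsub>R\<^esub> p i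
     else if j = 1 then \<ominus>\<^bsub>R\<^esub> q i
     else if j = i then \<one>\<^bsub>R\<^esub> else \<zero>\<^bsub>R\<^esub>)"

text \<open>
  The permutations that avoid the zeros of a bordered matrix. Put \<open>k = \<pi> 0\<close>. Row 1 takes one of
  the columns 0 and 1. If \<open>k \<ge> 2\<close>, then row \<open>k\<close> has lost its diagonal entry to row 0 and must
  take the other one of these two columns; if \<open>k < 2\<close>, then rows 0 and 1 take both. Either way
  the remaining rows have only their diagonal entries left.
\<close>

lemma permutes_bordered_pattern:
  fixes n :: nat
  assumes n: "n \<ge> 2"
    and \<pi>: "\<pi> permutes {0..<n}"
    and row1: "\<pi> 1 \<in> {0, 1}"
    and rows: "\<And>i. i \<in> {2..<n} \<Longrightarrow> \<pi> i \<in> {0, 1, i}"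
  shows "\<pi> \<in> transpose 0 ` insert 0 {2..<n} \<union>
             (\<lambda>k. transpose 1 k \<circ> transpose 0 1) ` insert 1 {2..<n}"
proof -
  let ?k = "\<pi> 0"
  have inj: "\<pi> i = \<pi> j \<longleftrightarrow> i = j" for i j
    using permutes_inj[OF \<pi>] by (auto dest: injD)
  have k: "?k < n" using permutes_in_image[OF \<pi>, of 0] n by auto
  have out: "\<pi> i = i" if "i \<ge> n" for i
    using permutes_not_in[OF \<pi>] that by auto
  consider "\<pi> 1 = 1" | "\<pi> 1 = 0" using row1 by auto
  then show ?thesis
  proof cases
    case 1
    then have k1: "?k \<noteq> 1" using inj[of 0 1] by auto
    have kk: "\<pi> ?k = 0" if "?k \<noteq> 0"
      using rows[of ?k] that k k1 inj[of ?k 1] inj[of ?k 0] 1 by auto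
    have rest: "\<pi> i = i" if "i \<noteq> 0" "i \<noteq> 1" "i \<noteq> ?k" for i
    proof (cases "i < n")
      case True
      then show ?thesis
        using rows[of i] that inj[of i 1] 1 kk inj[of i ?k] inj[of i 0] by fastforce
    qed (use out in auto)
    have "\<pi> i = transpose 0 ?k i" for i
      using 1 kk rest[of i] k1 by (cases "?k = 0") (auto simp: transpose_def)
    then have "\<pi> = transpose 0 ?k" by blast
    moreover have "?k \<in> insert 0 {2..<n}" using k k1 by auto
    ultimately show ?thesis by blast
  next
    case 2
    then have k0: "?k \<noteq> 0" using inj[of 0 1] by auto
    have kk: "\<pi> ?k = 1" if "?k \<noteq> 1"
      using rows[of ?k] that k k0 inj[of ?k 1] inj[of ?k 0] 2 by auto
    have rest: "\<pi> i = i" if "i \<noteq> 0" "i \<noteq> 1" "i \<noteq> ?k" for i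
    proof (cases "i < n")
      case True
      then show ?thesis
        using rows[of i] that inj[of i 1] 2 kk inj[of i ?k] inj[of i 0] by fastforce
    qed (use out in auto)
    have "\<pi> i = (transpose 1 ?k \<circ> transpose 0 1) i" for i
      using 2 kk rest[of i] k0 by (cases "?k = 1") (auto simp: transpose_def)
    then have "\<pi> = transpose 1 ?k \<circ> transpose 0 1" by blast
    moreover have "?k \<in> insert 1 {2..<n}" using k k0 by auto
    ultimately show ?thesis by blast
  qed
qed

lemma (in cring) finprod_zero_factor:
  assumes "finite A" "f \<in> A \<rightarrow> carrier R" "i \<in> A" "f i = \<zero>"
  shows "(\<Otimes>j\<in>A. f j) = \<zero>"
proof -
  have "(\<Otimes>j\<in>insert i (A - {i}). f j) = f i \<otimes> (\<Otimes>j\<in>A - {i}. f j)"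
    using assms by (intro finprod_insert) auto
  moreover have "(\<Otimes>j\<in>A - {i}. f j) \<in> carrier R"
    using assms by (intro finprod_closed) auto
  ultimately show ?thesis using assms by (simp add: insert_absorb)
qed

lemma (in cring) det_in_bordered_mat:
  assumes n: "n \<ge> 2"
    and a: "\<And>k. k < n \<Longrightarrow> a k \<in> carrier R"
    and p: "\<And>k. k < n \<Longrightarrow> p k \<in> carrier R"
    and q: "\<And>k. k < n \<Longrightarrow> q k \<in> carrier R"
    and uv: "u \<in> carrier R" "v \<in> carrier R"
  shows "det_in R (bordered_mat R n a p q u v) =
    (a 0 \<oplus> (\<Oplus>k\<in>{2..<n}. a k \<otimes> p k)) \<otimes> u \<oplus> (a 1 \<oplus> (\<Oplus>k\<in>{2..<n}. a k \<otimes> q k)) \<otimes> v"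
proof -
  define A where "A = bordered_mat R n a p q u v"
  define P where "P = {\<pi>. \<pi> permutes {0..<n}}"
  define prd where "prd \<pi> = (\<Otimes>i\<in>{0..<n}. A $$ (i, \<pi> i))" for \<pi>
  define F where "F \<pi> = (if evenperm \<pi> then prd \<pi> else \<ominus> prd \<pi>)" for \<pi>
  \<comment> \<open>The permutations that contribute: \<open>\<sigma> k\<close> and \<open>\<tau> k\<close> both send 0 to \<open>k\<close>, but
    \<open>\<sigma> k\<close> fixes 1, whereas \<open>\<tau> k\<close> sends 1 to 0. Here \<open>\<sigma> 0\<close> is the identity,
    \<open>\<tau> 1\<close> a transposition, and for \<open>k \<ge> 2\<close> they are a transposition and a 3-cycle. The terms of \<open>\<sigma> k\<close> add up to the multiple of \<open>u\<close>, those of \<open>\<tau> k\<close> to that of \<open>v\<close>.\<close>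
  define \<sigma> :: "nat \<Rightarrow> nat \<Rightarrow> nat" where "\<sigma> k = transpose 0 k" for k
  define \<tau> :: "nat \<Rightarrow> nat \<Rightarrow> nat" where "\<tau> k = transpose 1 k \<circ> transpose 0 1" for k
  let ?K = "{2..<n}"
  have idx: "{0..<n} = insert 0 (insert 1 ?K)" using n by auto

  have A_entry: "A $$ (i, j) =
     (if i = 0 then a j
     else if i = 1 then (if j = 0 then \<ominus> v else if j = 1 then u else \<zero>)
     else if j = 0 then \<ominus> p i
     else if j = 1 then \<ominus> q i
     else if j = i then \<one> else \<zero>)" if "i < n" "j < n" for i j
    using that unfolding A_def bordered_mat_def by simp
  have A_closed: "A $$ (i, j) \<in> carrier R" if "i < n" "j < n" for i j
    using that a p q uv by (simp add: A_entry)
  have perm_lt: "\<pi> i < n" if "\<pi> \<in> P" "i < n" for \<pi> i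
    using that permutes_in_image[of \<pi> "{0..<n}" i] unfolding P_def by auto
  have prd_closed: "prd \<pi> \<in> carrier R" if "\<pi> \<in> P" for \<pi>
    unfolding prd_def using perm_lt[OF that] A_closed by (intro finprod_closed) auto
  have F_closed: "F \<pi> \<in> carrier R" if "\<pi> \<in> P" for \<pi>
    unfolding F_def using prd_closed[OF that] by auto

  have prd_split: "prd \<pi> = A $$ (0, \<pi> 0) \<otimes> (A $$ (1, \<pi> 1) \<otimes> (\<Otimes>i\<in>?K. A $$ (i, \<pi> i)))"
    if "\<pi> \<in> P" for \<pi>
  proof -
    have "A $$ (i, \<pi> i) \<in> carrier R" if "i < n" for i
      using A_closed perm_lt \<open>\<pi> \<in> P\<close> that by auto
    then show ?thesis
      unfolding prd_def idx using n by (subst finprod_insert; (subst finprod_insert)?) auto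
  qed
  have prd_diag: "prd \<pi> = A $$ (0, \<pi> 0) \<otimes> A $$ (1, \<pi> 1)"
    if "\<pi> \<in> P" and diag: "\<And>i. i \<in> ?K \<Longrightarrow> \<pi> i = i" for \<pi>
  proof -
    have "(\<Otimes>i\<in>?K. A $$ (i, \<pi> i)) = \<one>"
      using diag by (intro finprod_one_eqI) (auto simp: A_entry)
    moreover have "A $$ (1, \<pi> 1) \<in> carrier R"
      using A_closed perm_lt[OF that(1), of 1] n by auto
    ultimately show ?thesis by (simp add: prd_split[OF that(1)])
  qed
  have prd_off_diag: "prd \<pi> = A $$ (0, \<pi> 0) \<otimes> A $$ (1, \<pi> 1) \<otimes> A $$ (k, \<pi> k)"
    if "\<pi> \<in> P" and k: "k \<in> ?K" and diag: "\<And>i. i \<in> ?K - {k} \<Longrightarrow> \<pi> i = i" for \<pi> k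
  proof -
    have cl: "A $$ (i, \<pi> i) \<in> carrier R" if "i < n" for i
      using A_closed perm_lt \<open>\<pi> \<in> P\<close> that by auto
    have "(\<Otimes>i\<in>?K. A $$ (i, \<pi> i)) = (\<Otimes>i\<in>insert k (?K - {k}). A $$ (i, \<pi> i))"
      using k by (simp add: insert_absorb)
    also have "\<dots> = A $$ (k, \<pi> k) \<otimes> (\<Otimes>i\<in>?K - {k}. A $$ (i, \<pi> i))"
      using cl k by (intro finprod_insert) auto
    also have "(\<Otimes>i\<in>?K - {k}. A $$ (i, \<pi> i)) = \<one>"
      using diag by (intro finprod_one_eqI) (auto simp: A_entry)
    finally show ?thesis
      using cl[of 0] cl[of 1] cl[of k] n k by (simp add: prd_split[OF that(1)] m_assoc)
  qed

  have \<sigma>P: "\<sigma> k \<in> P" if "k \<in> insert 0 ?K" for k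
    unfolding P_def \<sigma>_def using that n by (auto intro!: permutes_swap_id)
  have \<tau>P: "\<tau> k \<in> P" if "k \<in> insert 1 ?K" for k
    unfolding P_def \<tau>_def mem_Collect_eq using that n
    by (intro permutes_compose permutes_swap_id) auto
  have even\<sigma>: "evenperm (\<sigma> k) \<longleftrightarrow> k = 0" for k
    unfolding \<sigma>_def by (auto simp: evenperm_swap)
  have even\<tau>: "evenperm (\<tau> k) \<longleftrightarrow> k \<noteq> 1" for k
    unfolding \<tau>_def by (subst evenperm_comp) (auto simp: evenperm_swap permutation_swap_id)

  have F\<sigma>0: "F (\<sigma> 0) = a 0 \<otimes> u"
    using n uv a prd_diag[OF \<sigma>P, of 0] by (simp add: F_def even\<sigma>) (simp add: \<sigma>_def A_entry)
  have F\<sigma>: "F (\<sigma> k) = a k \<otimes> p k \<otimes> u" if k: "k \<in> ?K" for k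
  proof -
    have "prd (\<sigma> k) = a k \<otimes> u \<otimes> \<ominus> p k"
      using k by (subst prd_off_diag[OF \<sigma>P k]) (auto simp: \<sigma>_def A_entry transpose_def)
    moreover have "\<ominus> (a k \<otimes> u \<otimes> \<ominus> p k) = a k \<otimes> p k \<otimes> u"
      using k a[of k] p[of k] uv by simp algebra
    ultimately show ?thesis using k by (simp add: F_def even\<sigma>)
  qed
  have F\<tau>1: "F (\<tau> 1) = a 1 \<otimes> v"
  proof -
    have "prd (\<tau> 1) = a 1 \<otimes> \<ominus> v"
      using n by (subst prd_diag[OF \<tau>P]) (auto simp: \<tau>_def A_entry transpose_def)
    moreover have "\<ominus> (a 1 \<otimes> \<ominus> v) = a 1 \<otimes> v"
      using n a[of 1] uv by simp algebra
    ultimately show ?thesis by (simp add: F_def even\<tau>)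
  qed
  have F\<tau>: "F (\<tau> k) = a k \<otimes> q k \<otimes> v" if k: "k \<in> ?K" for k
  proof -
    have "prd (\<tau> k) = a k \<otimes> \<ominus> v \<otimes> \<ominus> q k"
      using k by (subst prd_off_diag[OF \<tau>P k]) (auto simp: \<tau>_def A_entry transpose_def)
    moreover have "a k \<otimes> \<ominus> v \<otimes> \<ominus> q k = a k \<otimes> q k \<otimes> v"
      using k a[of k] q[of k] uv by simp algebra
    ultimately show ?thesis using k by (simp add: F_def even\<tau>)
  qed

  have F_zero: "F \<pi> = \<zero>" if \<pi>: "\<pi> \<in> P - (\<sigma> ` insert 0 ?K \<union> \<tau> ` insert 1 ?K)" for \<pi>
  proof -
    have "\<not> (\<pi> 1 \<in> {0, 1} \<and> (\<forall>i\<in>?K. \<pi> i \<in> {0, 1, i}))"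
      using permutes_bordered_pattern[OF n, of \<pi>] \<pi> unfolding P_def \<sigma>_def \<tau>_def by blast
    then obtain i where i: "i < n" "A $$ (i, \<pi> i) = \<zero>"
    proof (cases "\<pi> 1 \<in> {0, 1}")
      case False
      then show thesis using that[of 1] n perm_lt[of \<pi> 1] \<pi> by (auto simp: A_entry)
    next
      case True
      then obtain i where "i \<in> ?K" "\<pi> i \<notin> {0, 1, i}"
        using \<open>\<not> (\<pi> 1 \<in> {0, 1} \<and> (\<forall>i\<in>?K. \<pi> i \<in> {0, 1, i}))\<close> by blast
      then show thesis using that[of i] perm_lt[of \<pi> i] \<pi> by (auto simp: A_entry)
    qed
    have "prd \<pi> = \<zero>"
      unfolding prd_def using i \<pi> perm_lt A_closed by (intro finprod_zero_factor[of _ _ i]) auto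
    then show ?thesis by (simp add: F_def)
  qed

  have \<sigma>_at_0: "\<sigma> k 0 = k" for k unfolding \<sigma>_def by simp
  have \<tau>_at_0: "\<tau> k 0 = k" for k unfolding \<tau>_def by simp
  have inj: "inj_on \<sigma> B" "inj_on \<tau> B" for B
    by (rule inj_on_inverseI[of _ "\<lambda>\<pi>. \<pi> 0"], simp add: \<sigma>_at_0 \<tau>_at_0)+
  have \<sigma>_at_1: "\<sigma> k 1 = 1" if "k \<in> insert 0 ?K" for k
    using that unfolding \<sigma>_def by (auto simp: transpose_def)
  have \<tau>_at_1: "\<tau> k 1 = 0" if "k \<in> insert 1 ?K" for k
    using that unfolding \<tau>_def by (auto simp: transpose_def)
  have disj: "\<sigma> ` insert 0 ?K \<inter> \<tau> ` insert 1 ?K = {}"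
  proof (intro equals0I)
    fix \<pi> assume "\<pi> \<in> \<sigma> ` insert 0 ?K \<inter> \<tau> ` insert 1 ?K"
    then obtain k l where "k \<in> insert 0 ?K" "\<pi> = \<sigma> k" "l \<in> insert 1 ?K" "\<pi> = \<tau> l"
      by (elim IntE imageE)
    then have "\<pi> 1 = 1" "\<pi> 1 = 0" using \<sigma>_at_1[of k] \<tau>_at_1[of l] by simp_all
    then show False by simp
  qed
  have sum\<sigma>: "(\<Oplus>\<pi>\<in>\<sigma> ` insert 0 ?K. F \<pi>) = (a 0 \<oplus> (\<Oplus>k\<in>?K. a k \<otimes> p k)) \<otimes> u"
  proof -
    have "(\<Oplus>\<pi>\<in>\<sigma> ` insert 0 ?K. F \<pi>) = (\<Oplus>k\<in>insert 0 ?K. F (\<sigma> k))"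
      by (rule finsum_reindex[OF _ inj(1)]) (use \<sigma>P F_closed in blast)
    also have "\<dots> = F (\<sigma> 0) \<oplus> (\<Oplus>k\<in>?K. F (\<sigma> k))"
      using \<sigma>P F_closed by (intro finsum_insert) auto
    also have "(\<Oplus>k\<in>?K. F (\<sigma> k)) = (\<Oplus>k\<in>?K. a k \<otimes> p k \<otimes> u)"
      using F\<sigma> a p uv by (intro finsum_cong') auto
    also have "\<dots> = (\<Oplus>k\<in>?K. a k \<otimes> p k) \<otimes> u"
      using a p uv by (intro finsum_ldistr[symmetric]) auto
    finally show ?thesis
      using a p uv n F\<sigma>0 by (simp add: l_distr finsum_closed Pi_def)
  qed
  have sum\<tau>: "(\<Oplus>\<pi>\<in>\<tau> ` insert 1 ?K. F \<pi>) = (a 1 \<oplus> (\<Oplus>k\<in>?K. a k \<otimes> q k)) \<otimes> v"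
  proof -
    have "(\<Oplus>\<pi>\<in>\<tau> ` insert 1 ?K. F \<pi>) = (\<Oplus>k\<in>insert 1 ?K. F (\<tau> k))"
      by (rule finsum_reindex[OF _ inj(2)]) (use \<tau>P F_closed in blast)
    also have "\<dots> = F (\<tau> 1) \<oplus> (\<Oplus>k\<in>?K. F (\<tau> k))"
      using \<tau>P F_closed by (intro finsum_insert) auto
    also have "(\<Oplus>k\<in>?K. F (\<tau> k)) = (\<Oplus>k\<in>?K. a k \<otimes> q k \<otimes> v)"
      using F\<tau> a q uv by (intro finsum_cong') auto
    also have "\<dots> = (\<Oplus>k\<in>?K. a k \<otimes> q k) \<otimes> v"
      using a q uv by (intro finsum_ldistr[symmetric]) auto
    finally show ?thesis
      using a q uv n F\<tau>1 by (simp add: l_distr finsum_closed Pi_def)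
  qed

  have dim_A: "dim_row A = n" unfolding A_def bordered_mat_def by simp
  have "det_in R A = (\<Oplus>\<pi>\<in>P. F \<pi>)"
    unfolding det_in_def P_def F_def prd_def Let_def dim_A ..
  also have "\<dots> = (\<Oplus>\<pi>\<in>\<sigma> ` insert 0 ?K \<union> \<tau> ` insert 1 ?K. F \<pi>)"
  proof (rule add.finprod_mono_neutral_cong_right)
    show "finite P" unfolding P_def by (simp add: finite_permutations)
  qed (use \<sigma>P \<tau>P F_zero F_closed in auto)
  also have "\<dots> = (\<Oplus>\<pi>\<in>\<sigma> ` insert 0 ?K. F \<pi>) \<oplus> (\<Oplus>\<pi>\<in>\<tau> ` insert 1 ?K. F \<pi>)"
    using disj \<sigma>P \<tau>P F_closed by (intro finsum_Un_disjoint) auto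
  finally show ?thesis unfolding A_def sum\<sigma> sum\<tau> .
qed

section \<open>Completing a row\<close>

lemma (in cring) J_stable_imp_strongly_completable:
  assumes J: "J_stable R"
  shows "strongly_completable R"
  unfolding strongly_completable_def
proof (intro allI impI ballI)
  fix n :: nat and a d
  assume n: "n \<ge> 2" and a: "a \<in> carrier_vec n" and d: "d \<in> carrier R"
    and entries: "set\<^sub>v a \<subseteq> carrier R" and span: "span_vec R a = PIdl d"
  have ak: "a $ k \<in> carrier R" if "k < n" for k
    using that a entries vec_setI[of a k] by auto
  have span': "{\<Oplus>k\<in>{0..<n}. a $ k \<otimes> x k | x. x \<in> {0..<n} \<rightarrow> carrier R} = PIdl d"
    using span a unfolding span_vec_def by simp
  obtain p q u v where
    pq: "\<And>k. k < n \<Longrightarrow> p k \<in> carrier R" "\<And>k. k < n \<Longrightarrow> q k \<in> carrier R"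
    and uv: "u \<in> carrier R" "v \<in> carrier R"
    and comb: "d = (a $ 0 \<oplus> (\<Oplus>k\<in>{2..<n}. a $ k \<otimes> p k)) \<otimes> u
                 \<oplus> (a $ 1 \<oplus> (\<Oplus>k\<in>{2..<n}. a $ k \<otimes> q k)) \<otimes> v"
    using ak by (rule J_stable_two_term_combination[where a = "($) a", OF J n _ d span']) blast+
  let ?A = "bordered_mat R n (($) a) p q u v"
  have "?A \<in> carrier_mat n n"
    unfolding bordered_mat_def by simp
  moreover have "elements_mat ?A \<subseteq> carrier R"
    unfolding elements_mat_def bordered_mat_def using ak pq uv by auto
  moreover have "row ?A 0 = a"
    using n a unfolding bordered_mat_def by (intro eq_vecI) auto
  moreover have "det_in R ?A = d"
    using det_in_bordered_mat[where a = "($) a", OF n ak pq uv] comb by simp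
  ultimately show "\<exists>A\<in>carrier_mat n n. elements_mat A \<subseteq> carrier R \<and> row A 0 = a \<and> det_in R A = d"
    by blast
qed

theorem theorem4p11:
  fixes R :: "('a, 'b) ring_scheme"
  assumes "cring R"
    and "J_stable R"
  shows "strongly_completable R"
  using assms by (rule cring.J_stable_imp_strongly_completable)

end
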